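(* $$\lim_{k \to \infty} c_k = 1.$$
   Context: A subset $A$ of an additive group is called sumfree if $x+y\neq z$ for all $x,y,z\in A$ (not necessarily distinct). For a positive integer $k$, subsets of $\{1,\ldots,n\}^k$ are regarded as subsets of the additive group $\mathbb{Z}^k$, and $$c_k := \limsup_{n \to \infty} \frac{1}{n^k} \max \{\#S : S \subset \{1,\ldots,n\}^k \text{ is sumfree}\}.$$ *)

theory Defs
  imports "HOL-Analysis.Analysis" "HOL-Library.Function_Algebras"
begin

definition sumfree :: "'a::group_add set \<Rightarrow> bool" where
  "sumfree A \<longleftrightarrow> (\<forall>x\<in>A. \<forall>y\<in>A. \<forall>z\<in>A. x + y \<noteq> z)"

text \<open>
  Since the dimension \<open>k\<close> varies, the group of integer vectors of length \<open>k\<close> is represented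
  as the subgroup of \<open>nat \<Rightarrow> int\<close> (with the pointwise addition of
  \<^theory>\<open>HOL-Library.Function_Algebras\<close>) of all functions that vanish outside \<open>{..<k}\<close>.
  The coordinates are thus numbered from \<open>0\<close> to \<open>k - 1\<close>.
\<close>

definition cube :: "nat \<Rightarrow> nat \<Rightarrow> (nat \<Rightarrow> int) set" where
  "cube k n = {x. (\<forall>i<k. x i \<in> {1..int n}) \<and> (\<forall>i\<ge>k. x i = 0)}"

definition max_sumfree :: "nat \<Rightarrow> nat \<Rightarrow> nat" where
  "max_sumfree k n = Max {card S | S. S \<subseteq> cube k n \<and> sumfree S}"

text \<open>
  The upper limit is taken in \<^typ>\<open>ereal\<close>, where it always exists; the sequence is bounded by
  \<open>0\<close> and \<open>1\<close>. The term for \<open>n = 0\<close> and the value for \<open>k = 0\<close> carry no meaning and do not affect limits.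
\<close>

definition sumfree_density :: "nat \<Rightarrow> ereal" where
  "sumfree_density k = limsup (\<lambda>n. ereal (real (max_sumfree k n) / real n ^ k))"

end

theory Submission
  imports Defs
begin

text \<open>
  Vectors whose coordinate sum lies in a half-open interval \<open>[L, 2L)\<close> form a sumfree set. The
  coordinate sum of a random point of the cube has mean \<open>k(n+1)/2\<close> and variance \<open>O(k n\<^sup>2)\<close>, so for
  \<open>L = k(n+1)/3\<close> Chebyshev's inequality shows that the slab misses only a proportion \<open>O(1/k)\<close> of
  the cube, uniformly in \<open>n\<close>.
\<close>

text \<open>Splitting off the last coordinate lets sums and cardinalities over the cube be computed
  by induction on the dimension. Points of \<open>cube k n\<close> vanish at \<open>k\<close>, so
  resetting that coordinate to 0 inverts the update.\<close>

lemma bij_betw_cube_Suc: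
  "bij_betw (\<lambda>(x, a). x(k := a)) (cube k n \<times> {1..int n}) (cube (Suc k) n)"
  by (rule bij_betw_byWitness[where f' = "\<lambda>x. (x(k := 0), x k)"])
    (auto simp: cube_def fun_eq_iff less_Suc_eq)

lemma cube_0: "cube 0 n = {\<lambda>_. 0}"
  by (auto simp: cube_def fun_eq_iff)

lemma sum_cube_Suc:
  "(\<Sum>x\<in>cube (Suc k) n. f x) = (\<Sum>x\<in>cube k n. \<Sum>a\<in>{1..int n}. f (x(k := a)))"
  by (simp add: sum.reindex_bij_betw[OF bij_betw_cube_Suc, symmetric] sum.cartesian_product
      case_prod_unfold)

lemma finite_cube: "finite (cube k n)"
  by (induction k) (simp_all add: cube_0 flip: bij_betw_finite[OF bij_betw_cube_Suc])

lemma card_cube: "card (cube k n) = n ^ k"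
  by (induction k)
    (simp_all add: cube_0 card_cartesian_product flip: bij_betw_same_card[OF bij_betw_cube_Suc])

text \<open>Twice the difference between the coordinate sum and its mean \<open>k(n+1)/2\<close>;
  the doubling keeps it an integer.\<close>

definition deviation :: "nat \<Rightarrow> nat \<Rightarrow> (nat \<Rightarrow> int) \<Rightarrow> int" where
  "deviation k n x = (\<Sum>i<k. 2 * x i - (int n + 1))"

lemma deviation_Suc: "deviation (Suc k) n (x(k := a)) = deviation k n x + (2 * a - (int n + 1))"
  by (simp add: deviation_def)

lemma deviation_eq: "deviation k n x = 2 * (\<Sum>i<k. x i) - int k * (int n + 1)"
  by (simp add: deviation_def sum_subtractf sum_distrib_left)

text \<open>The reflection of \<open>a\<close> to \<open>n + 1 - a\<close> negates every term, so
  the sum equals its own negative.\<close>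

lemma sum_centered: "(\<Sum>a\<in>{1..int n}. 2 * a - (int n + 1)) = 0"
proof -
  have "(\<Sum>a\<in>{1..int n}. 2 * a - (int n + 1)) = (\<Sum>a\<in>{1..int n}. - (2 * a - (int n + 1)))"
    by (rule sum.reindex_bij_witness[where i = "\<lambda>a. int n + 1 - a" and j = "\<lambda>a. int n + 1 - a"]) auto
  then show ?thesis
    by (simp only: sum_negf)
qed

lemma sum_centered_square_le: "(\<Sum>a\<in>{1..int n}. (2 * a - (int n + 1))\<^sup>2) \<le> int n ^ 3"
proof -
  have "(\<Sum>a\<in>{1..int n}. (2 * a - (int n + 1))\<^sup>2) \<le> of_nat (card {1..int n}) * (int n)\<^sup>2"
    by (rule sum_bounded_above) (auto intro!: power2_le_iff_abs_le[THEN iffD2])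
  then show ?thesis
    by (simp add: power2_eq_square power3_eq_cube)
qed

text \<open>The variance bound, not normalised by the \<open>n ^ k\<close> points. As for
  independent variables, each new coordinate only adds its own variance: the cross term vanishes by
  \<open>sum_centered\<close>.\<close>

lemma sum_deviation_square_le:
  "(\<Sum>x\<in>cube k n. (deviation k n x)\<^sup>2) \<le> int k * int n ^ (k + 2)"
proof (induction k)
  case 0
  then show ?case
    by (simp add: cube_0 deviation_def)
next
  case (Suc k)
  let ?c = "\<lambda>a. 2 * a - (int n + 1)"
  have inner: "(\<Sum>a\<in>{1..int n}. (deviation (Suc k) n (x(k := a)))\<^sup>2)
      \<le> int n * (deviation k n x)\<^sup>2 + int n ^ 3" for x
  proof -
    have "(\<Sum>a\<in>{1..int n}. (deviation (Suc k) n (x(k := a)))\<^sup>2)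
        = (\<Sum>a\<in>{1..int n}. (deviation k n x)\<^sup>2 + (?c a)\<^sup>2 + 2 * deviation k n x * ?c a)"
      by (simp only: deviation_Suc power2_sum)
    also have "\<dots> = int n * (deviation k n x)\<^sup>2 + (\<Sum>a\<in>{1..int n}. (?c a)\<^sup>2)
        + 2 * deviation k n x * (\<Sum>a\<in>{1..int n}. ?c a)"
      by (simp only: sum.distrib sum_distrib_left) simp
    finally show ?thesis
      using sum_centered_square_le[of n] by (simp only: sum_centered)
  qed
  have "(\<Sum>x\<in>cube (Suc k) n. (deviation (Suc k) n x)\<^sup>2)
      \<le> (\<Sum>x\<in>cube k n. int n * (deviation k n x)\<^sup>2 + int n ^ 3)"
    unfolding sum_cube_Suc by (intro sum_mono inner)
  also have "\<dots> = int n * (\<Sum>x\<in>cube k n. (deviation k n x)\<^sup>2) + int n ^ k * int n ^ 3"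
    by (simp add: sum.distrib sum_distrib_left card_cube)
  also have "\<dots> \<le> int n * (int k * int n ^ (k + 2)) + int n ^ k * int n ^ 3"
    using Suc by (simp add: mult_left_mono)
  also have "\<dots> = int (Suc k) * int n ^ (Suc k + 2)"
    by (simp add: algebra_simps power_add power2_eq_square power3_eq_cube)
  finally show ?case .
qed

text \<open>The condition \<open>L \<le> sum < 2L\<close> for \<open>L = k(n+1)/3\<close>,
  multiplied by 3 to stay in the integers. This \<open>L\<close> places the mean halfway between the
  two bounds.\<close>

definition slab :: "nat \<Rightarrow> nat \<Rightarrow> (nat \<Rightarrow> int) set" where
  "slab k n = {x \<in> cube k n. int k * (int n + 1) \<le> 3 * (\<Sum>i<k. x i) \<and>
     3 * (\<Sum>i<k. x i) < 2 * (int k * (int n + 1))}"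

lemma slab_subset: "slab k n \<subseteq> cube k n"
  by (auto simp: slab_def)

text \<open>Two coordinate sums that are at least \<open>L\<close> add up to at least
  \<open>2L\<close>, which the strict upper bound excludes.\<close>

lemma sumfree_slab: "sumfree (slab k n)"
  unfolding sumfree_def
proof (intro ballI notI)
  fix x y z assume "x \<in> slab k n" "y \<in> slab k n" "z \<in> slab k n" and "x + y = z"
  moreover from this have "(\<Sum>i<k. z i) = (\<Sum>i<k. x i) + (\<Sum>i<k. y i)"
    by (auto simp: sum.distrib)
  ultimately show False
    by (simp add: slab_def)
qed

lemma card_cube_minus_slab_le:
  assumes "k > 0"
  shows "real (card (cube k n - slab k n)) \<le> 9 / real k * real n ^ k"
proof (cases "n = 0")
  case True
  then have "cube k n = {}"
    using assms by (auto simp: cube_def)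
  then show ?thesis
    by simp
next
  case False
  define B where "B = cube k n - slab k n"
  have far: "(int k * int n)\<^sup>2 \<le> 9 * (deviation k n x)\<^sup>2" if "x \<in> B" for x
  proof -
    \<comment> \<open>Both ends of the slab lie at distance \<open>k(n+1)/6\<close> from the mean,
      hence at \<open>k(n+1)/3\<close> on the doubled scale of \<open>deviation\<close>.\<close>
    have "int k * (int n + 1) \<le> \<bar>3 * deviation k n x\<bar>"
      using that by (auto simp: B_def slab_def deviation_eq)
    then have "int k * int n \<le> \<bar>3 * deviation k n x\<bar>"
      by (simp add: distrib_left)
    then have "(int k * int n)\<^sup>2 \<le> \<bar>3 * deviation k n x\<bar>\<^sup>2"
      by (intro power_mono) auto
    then show ?thesis
      by (simp add: power_mult_distrib)
  qed
  \<comment> \<open>Chebyshev's inequality in counting form: every point of \<open>B\<close>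
    contributes at least \<open>(k n)\<^sup>2\<close> to the second moment.\<close>
  have "int (card B) * (int k * int n)\<^sup>2 \<le> (\<Sum>x\<in>B. 9 * (deviation k n x)\<^sup>2)"
    using far by (intro sum_bounded_below)
  also have "\<dots> \<le> (\<Sum>x\<in>cube k n. 9 * (deviation k n x)\<^sup>2)"
    by (intro sum_mono2) (auto simp: finite_cube B_def)
  also have "\<dots> \<le> 9 * (int k * int n ^ (k + 2))"
    unfolding sum_distrib_left[symmetric] by (intro mult_left_mono sum_deviation_square_le) simp
  \<comment> \<open>The common factor is pulled to the front to be cancelled; it is positive because
    \<open>n = 0\<close> was treated separately.\<close>
  finally have "(int k * (int n)\<^sup>2) * (int (card B) * int k) \<le> (int k * (int n)\<^sup>2) * (9 * int n ^ k)"
    by (simp add: power2_eq_square power_add mult_ac)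
  moreover have "0 < int k * (int n)\<^sup>2"
    using assms False by simp
  ultimately have "int (card B) * int k \<le> 9 * int n ^ k"
    by (simp only: mult_le_cancel_left_pos)
  then have "real_of_int (int (card B) * int k) \<le> real_of_int (9 * int n ^ k)"
    by (simp only: of_int_le_iff)
  then have "real (card B) * real k \<le> 9 * real n ^ k"
    by simp
  then show ?thesis
    using assms by (simp add: B_def field_simps)
qed

lemma finite_card_sumfree: "finite {card S | S. S \<subseteq> cube k n \<and> sumfree S}"
proof -
  have "finite (card ` Pow (cube k n))"
    by (simp add: finite_cube)
  then show ?thesis
    by (rule finite_subset[rotated]) auto
qed

lemma max_sumfree_ge:
  assumes "S \<subseteq> cube k n" "sumfree S"
  shows "card S \<le> max_sumfree k n"
  unfolding max_sumfree_def using assms by (intro Max_ge finite_card_sumfree) auto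

lemma max_sumfree_le: "max_sumfree k n \<le> n ^ k"
  unfolding max_sumfree_def
proof (rule Max.boundedI[OF finite_card_sumfree])
  show "{card S | S. S \<subseteq> cube k n \<and> sumfree S} \<noteq> {}"
    using slab_subset sumfree_slab by blast
qed (auto simp: finite_cube card_mono simp flip: card_cube)

lemma max_sumfree_density_ge:
  assumes "k > 0" "n > 0"
  shows "1 - 9 / real k \<le> real (max_sumfree k n) / real n ^ k"
proof -
  have "card (cube k n) = card (slab k n) + card (cube k n - slab k n)"
    using card_Un_disjoint[of "slab k n" "cube k n - slab k n"] slab_subset[of k n] finite_cube[of k n]
    by (simp add: finite_subset Un_absorb1)
  then have "real n ^ k = real (card (slab k n)) + real (card (cube k n - slab k n))"
    by (simp only: card_cube flip: of_nat_add of_nat_power)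
  also have "\<dots> \<le> real (max_sumfree k n) + 9 / real k * real n ^ k"
    using max_sumfree_ge[OF slab_subset sumfree_slab] card_cube_minus_slab_le[OF assms(1)]
    by (intro add_mono) auto
  finally have "(1 - 9 / real k) * real n ^ k \<le> real (max_sumfree k n)"
    by (simp add: left_diff_distrib)
  then show ?thesis
    using assms by (simp add: pos_le_divide_eq)
qed

lemma sumfree_density_le: "sumfree_density k \<le> 1"
  unfolding sumfree_density_def
proof (intro Limsup_bounded always_eventually allI)
  fix n
  have "real (max_sumfree k n) \<le> real n ^ k"
    using max_sumfree_le[of k n] by (metis of_nat_le_iff of_nat_power)
  then have "real (max_sumfree k n) / real n ^ k \<le> real n ^ k / real n ^ k"
    by (intro divide_right_mono) simp_all
  \<comment> \<open>Only an inequality, since the quotient is 0 when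
    \<open>n ^ k = 0\<close>.\<close>
  also have "\<dots> \<le> 1"
    by (simp add: divide_self_if)
  finally have "real (max_sumfree k n) / real n ^ k \<le> 1" .
  then show "ereal (real (max_sumfree k n) / real n ^ k) \<le> 1"
    by simp
qed

text \<open>The bound on the proportion does not depend on \<open>n\<close>, so it passes to the
  upper limit.\<close>

lemma sumfree_density_ge:
  assumes "k > 0"
  shows "ereal (1 - 9 / real k) \<le> sumfree_density k"
  unfolding sumfree_density_def
proof (rule le_Limsup)
  show "\<forall>\<^sub>F n in sequentially. ereal (1 - 9 / real k) \<le> ereal (real (max_sumfree k n) / real n ^ k)"
    using eventually_gt_at_top[of 0]
    by eventually_elim (simp only: ereal_less_eq max_sumfree_density_ge[OF assms])
qed simp

theorem corollary1p2:
  shows "sumfree_density \<longlonglongrightarrow> 1"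
proof (rule tendsto_sandwich)
  show "\<forall>\<^sub>F k in sequentially. ereal (1 - 9 / real k) \<le> sumfree_density k"
    using eventually_gt_at_top[of 0] by eventually_elim (rule sumfree_density_ge)
  show "\<forall>\<^sub>F k in sequentially. sumfree_density k \<le> 1"
    by (simp add: sumfree_density_le)
  have "(\<lambda>k. 1 - 9 / real k) \<longlonglongrightarrow> 1 - 0"
    by (intro tendsto_diff tendsto_const lim_const_over_n)
  then show "(\<lambda>k. ereal (1 - 9 / real k)) \<longlonglongrightarrow> 1"
    by (simp add: one_ereal_def)
qed simp

end
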